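(* Consider a two-level system, initially excited with probability $p_0$, undergoing a finite-time process in which its energy gap is driven from $\delta_{\max}$ to $\delta_{\min}$ in $L$ discrete steps along with partial thermalizations, with respect to a bath at temperature $T_h$ and with thermalization rate $\kappa$, for a finite total time $\tau$. The gap at time $t\in[0,\tau]$ is $\delta(t)$, with $\delta(0)=\delta_{\max}$ and $\delta(\tau)=\delta_{\min}$; the driving is general and, in particular, is not required to be at a constant rate. Let $W_L$ be the random variable denoting the total work done during the process, and let $\epsilon=\delta_{\max}-\delta_{\min}$. Then, in general, $$\lim_{L\to\infty}\Pr[W_L=0]=(1-p_0)\,e^{-\kappa\int_0^\tau\gamma_h(\delta(t))\,dt}$$ and $$\lim_{L\to\infty}\Pr[W_L=\epsilon]=p_0\,e^{-\kappa\int_0^\tau\left(1-\gamma_h(\delta(t))\right)dt},$$ where $L\to\infty$ is the continuous time limit.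
   Context: The ground state energy is zero, the gap can only be driven within the range between $\delta_{\min}$ and $\delta_{\max}$, and $\gamma_h(\delta)=\frac{1}{1+e^{\delta/T_h}}$ is the Gibbs weight of the excited state at bath temperature $T_h$. Discrete process with $L$ steps: each step takes time $\Delta t=\tau/L$ (with $L$ large enough that $\kappa\Delta t\le 1$). Let $X_0,X_1,\dots,X_L\in\{0,1\}$ be a time-inhomogeneous Markov chain ($0$ = ground state, $1$ = excited state) with $\Pr[X_0=1]=p_0$. In step $l\in\{1,\dots,L\}$, first a level transformation changes the gap from $\delta((l-1)\Delta t)$ to $\delta(l\Delta t)$ with the state $X_{l-1}$ unchanged, yielding work $X_{l-1}\big(\delta((l-1)\Delta t)-\delta(l\Delta t)\big)$; then a partial thermalization (yielding no work) leaves the state as it is with probability $1-\kappa\Delta t$ and, with probability $\kappa\Delta t$, replaces it by a state drawn from the Gibbs distribution with excited-state probability $\gamma_h(\delta(l\Delta t))$. That is, $$\Pr[X_l=1\mid X_{l-1}=0]=\kappa\Delta t\,\gamma_h(\delta(l\Delta t)),\qquad \Pr[X_l=0\mid X_{l-1}=1]=\kappa\Delta t\,\big(1-\gamma_h(\delta(l\Delta t))\big).$$ The total work (counted positive for a net work gain) is $W_L=\sum_{l=1}^{L}X_{l-1}\big(\delta((l-1)\Delta t)-\delta(l\Delta t)\big)$.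
   Formalization: The driving δ(t) is assumed almost everywhere continuous and to spend zero total time at any single gap value; without this the claim fails, e.g. if δ=δ_max on [0,τ/2] with p_0=1, relaxing then gives W_L=0 with positive limiting probability. *)

theory Defs
  imports "HOL-Probability.Probability"
begin

definition gibbs_excited :: "real \<Rightarrow> real \<Rightarrow> real" where
  "gibbs_excited T d = 1 / (1 + exp (d / T))"

text \<open>The grid time after \<open>l\<close> of \<open>L\<close> steps.\<close>

definition step_time :: "real \<Rightarrow> nat \<Rightarrow> nat \<Rightarrow> real" where
  "step_time \<tau> L l = real l * (\<tau> / real L)"

text \<open>
  \<open>X 0, \<dots>, X L\<close> is a Markov chain on the states \<open>0\<close> (ground) and \<open>1\<close> (excited). The target
  \<^term>\<open>count_space {0, 1}\<close> in \<open>measurable\<close> also restricts the values of each \<open>X l\<close> to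
  \<open>{0, 1}\<close>. Conditional probabilities are prescribed only where the conditioning event has
  positive probability. Here \<open>\<kappa> * (\<tau> / real L)\<close> is the probability that a partial thermalization
  resamples the state from the Gibbs distribution.
\<close>

locale two_level_process = prob_space M
  for M :: "'a measure" +
  fixes X :: "nat \<Rightarrow> 'a \<Rightarrow> nat"
    and L :: nat
    and p0 T \<kappa> \<tau> :: real
    and \<delta> :: "real \<Rightarrow> real"
  assumes measurable: "\<And>l. l \<le> L \<Longrightarrow> X l \<in> measurable M (count_space {0, 1})"
    and initial: "\<P>(\<omega> in M. X 0 \<omega> = 1) = p0"
    and markov: "\<And>l x y. l \<in> {1..L} \<Longrightarrow> \<P>(\<omega> in M. \<forall>i<l. X i \<omega> = x i) > 0 \<Longrightarrow>
      \<P>(\<omega> in M. X l \<omega> = y \<bar> \<forall>i<l. X i \<omega> = x i) =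
      \<P>(\<omega> in M. X l \<omega> = y \<bar> X (l - 1) \<omega> = x (l - 1))"
    and excite: "\<And>l. l \<in> {1..L} \<Longrightarrow> \<P>(\<omega> in M. X (l - 1) \<omega> = 0) > 0 \<Longrightarrow>
      \<P>(\<omega> in M. X l \<omega> = 1 \<bar> X (l - 1) \<omega> = 0) =
      \<kappa> * (\<tau> / real L) * gibbs_excited T (\<delta> (step_time \<tau> L l))"
    and relax: "\<And>l. l \<in> {1..L} \<Longrightarrow> \<P>(\<omega> in M. X (l - 1) \<omega> = 1) > 0 \<Longrightarrow>
      \<P>(\<omega> in M. X l \<omega> = 0 \<bar> X (l - 1) \<omega> = 1) =
      \<kappa> * (\<tau> / real L) * (1 - gibbs_excited T (\<delta> (step_time \<tau> L l)))"

definition total_work :: "(real \<Rightarrow> real) \<Rightarrow> real \<Rightarrow> nat \<Rightarrow> (nat \<Rightarrow> 'a \<Rightarrow> nat) \<Rightarrow> 'a \<Rightarrow> real" where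
  "total_work \<delta> \<tau> L X \<omega> =
    (\<Sum>l=1..L. real (X (l - 1) \<omega>) * (\<delta> (step_time \<tau> L (l - 1)) - \<delta> (step_time \<tau> L l)))"

text \<open>
  Admissible driving protocols on \<open>[0, \<tau>]\<close>. Almost-everywhere continuity (that is, Riemann
  integrability, as the gap is bounded) makes the continuous time limit meaningful. The gap may
  vary at any rate and need be neither continuous nor monotone, but it must not linger: a positive
  amount of time spent at one value of the gap would allow jumps that leave the total work
  unchanged, and these would contribute to the probability of zero work. Every strictly decreasing
  protocol, continuous or not, is admissible.
\<close>

definition gap_protocol :: "real \<Rightarrow> real \<Rightarrow> real \<Rightarrow> (real \<Rightarrow> real) \<Rightarrow> bool" where
  "gap_protocol \<delta>min \<delta>max \<tau> \<delta> \<longleftrightarrow>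
    \<delta> 0 = \<delta>max \<and> \<delta> \<tau> = \<delta>min \<and>
    (\<forall>t\<in>{0..\<tau>}. \<delta> t \<in> {\<delta>min..\<delta>max}) \<and>
    negligible {t \<in> {0..\<tau>}. \<not> continuous (at t within {0..\<tau>}) \<delta>} \<and>
    (\<forall>c. negligible {t \<in> {0..\<tau>}. \<delta> t = c})"

end

theory Submission
  imports Defs
begin

text \<open>
  A path without flips contributes total work \<open>0\<close> (always ground) or \<open>\<delta>max - \<delta>min\<close> (always excited),
  and its probability is a product that converges to the exponential of a Riemann integral. It
  remains to show that paths with a flip hit a prescribed value \<open>w\<close> of the work with vanishing
  probability. The work extracted so far plus the current energy changes only at flips, so the
  past of the last flip determines the value that the gap must have at that flip; this critical
  value is a function of the path that is itself constant between flips. A flip happens with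
  probability at most \<open>\<kappa> \<tau> / L\<close> in each step, the expected number of flips is at most \<open>\<kappa> \<tau>\<close>, and
  any single gap value is attained at only \<open>o(L)\<close> grid points, uniformly in the value. Hence the
  probability in question is at most \<open>(\<kappa> \<tau> / L) (1 + \<kappa> \<tau>) o(L)\<close>.
\<close>

subsection \<open>Sums over the time grid\<close>

text \<open>Sampling a function at the next grid point turns a sum over right end points of cells
  into an exact integral, so that limits of sums become limits of integrals.\<close>

definition round_up :: "real \<Rightarrow> nat \<Rightarrow> real \<Rightarrow> real" where
  "round_up \<tau> L t = step_time \<tau> L (nat \<lceil>t * real L / \<tau>\<rceil>)"

lemma step_time_mem:
  assumes "\<tau> > 0" "l \<le> L"
  shows "step_time \<tau> L l \<in> {0..\<tau>}"
proof (cases "L = 0")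
  case False
  with assms show ?thesis by (auto simp: step_time_def field_simps mult_left_mono)
qed (use assms in \<open>auto simp: step_time_def\<close>)

lemma round_up_between:
  assumes "\<tau> > 0" "L > 0" "t \<in> {0..\<tau>}"
  shows "t \<le> round_up \<tau> L t" "round_up \<tau> L t \<le> t + \<tau> / real L" "round_up \<tau> L t \<in> {0..\<tau>}"
proof -
  let ?z = "t * real L / \<tau>"
  have z0: "0 \<le> ?z" using assms by simp
  then have c0: "0 \<le> \<lceil>?z\<rceil>" by linarith
  have b: "?z \<le> real (nat \<lceil>?z\<rceil>)" "real (nat \<lceil>?z\<rceil>) \<le> ?z + 1" 
    using c0 by linarith+
  have "?z * (\<tau> / real L) \<le> real (nat \<lceil>?z\<rceil>) * (\<tau> / real L)"
       "real (nat \<lceil>?z\<rceil>) * (\<tau> / real L) \<le> (?z + 1) * (\<tau> / real L)"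
    by (intro mult_right_mono b; use assms in simp)+
  moreover have "?z * (\<tau> / real L) = t" "(?z + 1) * (\<tau> / real L) = t + \<tau> / real L"
    using assms by (auto simp: field_simps)
  ultimately show "t \<le> round_up \<tau> L t" "round_up \<tau> L t \<le> t + \<tau> / real L"
    by (simp_all add: round_up_def step_time_def)
  have "?z \<le> real L" using assms by (simp add: field_simps)
  then have "nat \<lceil>?z\<rceil> \<le> L" by (simp add: ceiling_le_iff nat_le_iff)
  then show "round_up \<tau> L t \<in> {0..\<tau>}"
    unfolding round_up_def using assms by (intro step_time_mem)
qed

lemma round_up_tendsto:
  assumes "\<tau> > 0" "t \<in> {0..\<tau>}" and L: "filterlim L at_top sequentially" "\<And>n. L n > (0::nat)"
  shows "(\<lambda>n. round_up \<tau> (L n) t) \<longlonglongrightarrow> t"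
proof (rule tendsto_sandwich[where f = "\<lambda>_. t" and h = "\<lambda>n. t + \<tau> / real (L n)"])
  have "filterlim (\<lambda>n. real (L n)) at_top sequentially"
    using L(1) by (rule filterlim_compose[OF filterlim_real_sequentially])
  then have "(\<lambda>n. t + \<tau> / real (L n)) \<longlonglongrightarrow> t + 0"
    by (intro tendsto_add tendsto_const tendsto_divide_0[OF tendsto_const] filterlim_at_top_imp_at_infinity)
  then show "(\<lambda>n. t + \<tau> / real (L n)) \<longlonglongrightarrow> t" by simp
  show "\<forall>\<^sub>F n in sequentially. t \<le> round_up \<tau> (L n) t"
    "\<forall>\<^sub>F n in sequentially. round_up \<tau> (L n) t \<le> t + \<tau> / real (L n)"
    using round_up_between[OF assms(1) L(2) assms(2)] by simp_all
qed simp

text \<open>Between two neighbouring grid points the rounded time is constant, so each cell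
  contributes its length times the value at its right end. The cells are glued one by one, hence the
  general upper end \<open>step_time \<tau> L k\<close>.\<close>

lemma has_integral_round_up:
  fixes g :: "real \<Rightarrow> real"
  assumes "\<tau> > 0" "L > 0"
  shows "((\<lambda>t. g (round_up \<tau> L t)) has_integral (\<tau> / real L) * (\<Sum>l=1..k. g (step_time \<tau> L l)))
    {0..step_time \<tau> L k}"
proof (induction k)
  case 0
  then show ?case by (simp add: step_time_def has_integral_refl)
next
  case (Suc k)
  let ?a = "step_time \<tau> L k" and ?b = "step_time \<tau> L (Suc k)"
  have ab: "?b = ?a + \<tau> / real L" by (simp add: step_time_def algebra_simps add_divide_distrib)
  have le: "0 \<le> ?a" "?a \<le> ?b" using assms by (auto simp: ab) (simp add: step_time_def)
  have "((\<lambda>t. g ?b) has_integral (\<tau> / real L) * g ?b) {?a..?b}"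
    using has_integral_const_real[of "g ?b" ?a ?b] le by (simp add: ab)
  then have "((\<lambda>t. g (round_up \<tau> L t)) has_integral (\<tau> / real L) * g ?b) {?a..?b}"
  proof (rule has_integral_spike_finite[rotated 2])
    \<comment> \<open>The left end point is itself a grid point and rounds to itself, so it is
      exempted as a finite exceptional set.\<close>
    fix t assume t: "t \<in> {?a..?b} - {?a}"
    then have "real k < t * real L / \<tau>" "t * real L / \<tau> \<le> real (Suc k)"
      using assms by (auto simp: step_time_def field_simps)
    then have "\<lceil>t * real L / \<tau>\<rceil> = int (Suc k)" by (intro ceiling_unique) auto
    then show "g (round_up \<tau> L t) = g ?b" by (simp only: round_up_def nat_int)
  qed simp
  from has_integral_combine[OF le Suc.IH this] show ?case
    by (simp add: algebra_simps)
qed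

text \<open>The sampled function may vary with \<open>n\<close>: this covers moving level sets as well as Riemann sums.\<close>

lemma grid_sums_tendsto_integral:
  fixes g :: "nat \<Rightarrow> real \<Rightarrow> real" and f :: "real \<Rightarrow> real"
  assumes \<tau>: "\<tau> > 0" and L: "filterlim L at_top sequentially" "\<And>n. L n > (0::nat)"
    and bound: "\<And>n t. t \<in> {0..\<tau>} \<Longrightarrow> \<bar>g n t\<bar> \<le> B"
    and N: "negligible N"
    and lim: "\<And>t. t \<in> {0..\<tau>} - N \<Longrightarrow> (\<lambda>n. g n (round_up \<tau> (L n) t)) \<longlonglongrightarrow> f t"
  shows "(\<lambda>n. (\<tau> / real (L n)) * (\<Sum>l=1..L n. g n (step_time \<tau> (L n) l))) \<longlonglongrightarrow> integral {0..\<tau>} f"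
proof -
  \<comment> \<open>Dominated convergence is applied with convergence at every point, so both sides
    are set to \<open>0\<close> on \<open>N\<close>; this changes no integral.\<close>
  let ?G = "\<lambda>n t. if t \<in> N then 0 else g n (round_up \<tau> (L n) t)"
  let ?F = "\<lambda>t. if t \<in> N then 0 else f t"
  let ?S = "\<lambda>n. (\<tau> / real (L n)) * (\<Sum>l=1..L n. g n (step_time \<tau> (L n) l))"
  have hi: "(?G n has_integral ?S n) {0..\<tau>}" for n
  proof (rule has_integral_spike[OF N])
    have "step_time \<tau> (L n) (L n) = \<tau>" using L(2)[of n] by (simp add: step_time_def)
    then show "((\<lambda>t. g n (round_up \<tau> (L n) t)) has_integral ?S n) {0..\<tau>}"
      using has_integral_round_up[OF \<tau> L(2), of "g n" n "L n"] by simp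
  qed auto
  have "(\<lambda>n. integral {0..\<tau>} (?G n)) \<longlonglongrightarrow> integral {0..\<tau>} ?F"
  proof (rule dominated_convergence(2)[where h = "\<lambda>_. \<bar>B\<bar>"])
    show "?G n integrable_on {0..\<tau>}" for n using hi by blast
    show "norm (?G n t) \<le> \<bar>B\<bar>" if "t \<in> {0..\<tau>}" for n t
      using bound[OF round_up_between(3)[OF \<tau> L(2) that], of n n] by auto
    show "(\<lambda>n. ?G n t) \<longlonglongrightarrow> ?F t" if "t \<in> {0..\<tau>}" for t
      using lim that by auto
  qed auto
  moreover have "integral {0..\<tau>} (?G n) = ?S n" for n using hi by (rule integral_unique)
  moreover have "integral {0..\<tau>} ?F = integral {0..\<tau>} f"
    by (rule integral_spike[OF N]) auto
  ultimately show ?thesis by simp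
qed

text \<open>At every continuity point \<open>t\<close> the rounded times tend to \<open>t\<close>,
  and so do the sampled values to \<open>f t\<close>; the remaining points are negligible.\<close>

lemma riemann_sums_tendsto:
  fixes f :: "real \<Rightarrow> real"
  assumes \<tau>: "\<tau> > 0" and L: "filterlim L at_top sequentially" "\<And>n. L n > (0::nat)"
    and bound: "\<And>t. t \<in> {0..\<tau>} \<Longrightarrow> \<bar>f t\<bar> \<le> B"
    and N: "negligible {t \<in> {0..\<tau>}. \<not> continuous (at t within {0..\<tau>}) f}"
  shows "(\<lambda>n. (\<tau> / real (L n)) * (\<Sum>l=1..L n. f (step_time \<tau> (L n) l))) \<longlonglongrightarrow> integral {0..\<tau>} f"
proof (rule grid_sums_tendsto_integral[OF \<tau> L bound N])
  fix t assume t: "t \<in> {0..\<tau>} - {t \<in> {0..\<tau>}. \<not> continuous (at t within {0..\<tau>}) f}"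
  then show "(\<lambda>n. f (round_up \<tau> (L n) t)) \<longlonglongrightarrow> f t"
    using round_up_between(3)[OF \<tau> L(2)]
    by (intro continuous_within_tendsto_compose'[of t "{0..\<tau>}" f] round_up_tendsto[OF \<tau> _ L]) auto
qed

text \<open>The bound is uniform in \<open>c\<close> because the critical gap depends on the path.
  If it failed, there would be ever finer grids with levels hit by more than a fraction
  \<open>\<eta>\<close> of the grid points. By compactness these levels converge along a subsequence
  to some \<open>c0\<close>. Almost every \<open>t\<close> is a continuity point with
  \<open>d t \<noteq> c0\<close>, where the rounded value eventually misses the moving level, so the
  fraction tends to \<open>0\<close>.\<close>

lemma level_count_small:
  fixes d :: "real \<Rightarrow> real"
  assumes \<tau>: "\<tau> > 0" and \<eta>: "\<eta> > 0"
    and range: "\<And>t. t \<in> {0..\<tau>} \<Longrightarrow> d t \<in> {a..b}"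
    and cont: "negligible {t \<in> {0..\<tau>}. \<not> continuous (at t within {0..\<tau>}) d}"
    and level: "\<And>c. negligible {t \<in> {0..\<tau>}. d t = c}"
  shows "\<exists>K. \<forall>L\<ge>K. \<forall>c. real (card {l \<in> {1..L}. d (step_time \<tau> L l) = c}) \<le> \<eta> * real L"
proof (rule ccontr)
  assume "\<not> ?thesis"
  \<comment> \<open>Asking for \<open>Suc K\<close> makes every chosen grid size positive and the
    sizes unbounded.\<close>
  then have "\<forall>K. \<exists>L c. L \<ge> Suc K \<and> real (card {l \<in> {1..L}. d (step_time \<tau> L l) = c}) > \<eta> * real L"
    by (meson not_le)
  then obtain L c where L: "\<And>n. L n \<ge> Suc n"
    and big: "\<And>n. real (card {l \<in> {1..L n}. d (step_time \<tau> (L n) l) = c n}) > \<eta> * real (L n)"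
    by metis
  \<comment> \<open>The count exceeds a nonnegative number, so the level is attained at some grid
    time and lies in the range of \<open>d\<close>.\<close>
  have "c n \<in> {a..b}" for n
  proof -
    have "card {l \<in> {1..L n}. d (step_time \<tau> (L n) l) = c n} \<noteq> 0"
      using big[of n] \<eta> by (metis mult_nonneg_nonneg not_le of_nat_0 of_nat_0_le_iff less_imp_le)
    then obtain l where l: "l \<in> {1..L n}" "d (step_time \<tau> (L n) l) = c n"
      by (metis (mono_tags, lifting) card.empty empty_Collect_eq)
    then have "step_time \<tau> (L n) l \<in> {0..\<tau>}" by (intro step_time_mem[OF \<tau>]) simp
    then show ?thesis using range l(2) by metis
  qed
  then obtain c0 r where r: "strict_mono (r :: nat \<Rightarrow> nat)" and c0: "(c \<circ> r) \<longlonglongrightarrow> c0"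
    using compact_Icc[of a b] unfolding compact_def by metis
  let ?L = "L \<circ> r"
  have Lpos: "?L n > 0" for n using L[of "r n"] by simp
  have Lge: "n \<le> ?L n" for n using L[of "r n"] seq_suble[OF r, of n] by simp
  then have Llim: "filterlim ?L at_top sequentially"
    by (intro filterlim_at_top_mono[OF filterlim_ident]) auto
  let ?g = "\<lambda>n t. if d t = c (r n) then 1 else 0 :: real"
  have "(\<lambda>n. (\<tau> / real (?L n)) * (\<Sum>l=1..?L n. ?g n (step_time \<tau> (?L n) l)))
     \<longlonglongrightarrow> integral {0..\<tau>} (\<lambda>_. 0)"
  proof (rule grid_sums_tendsto_integral[OF \<tau> Llim Lpos, where B = 1])
    show "negligible ({t \<in> {0..\<tau>}. \<not> continuous (at t within {0..\<tau>}) d} \<union> {t \<in> {0..\<tau>}. d t = c0})"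
      using cont level by (rule negligible_Un)
    fix t assume t: "t \<in> {0..\<tau>} -
      ({t \<in> {0..\<tau>}. \<not> continuous (at t within {0..\<tau>}) d} \<union> {t \<in> {0..\<tau>}. d t = c0})"
    then have "(\<lambda>n. d (round_up \<tau> (?L n) t)) \<longlonglongrightarrow> d t"
      using round_up_between(3)[OF \<tau> Lpos]
      by (intro continuous_within_tendsto_compose'[of t "{0..\<tau>}" d] round_up_tendsto[OF \<tau> _ Llim Lpos]) auto
    then have "(\<lambda>n. d (round_up \<tau> (?L n) t) - (c \<circ> r) n) \<longlonglongrightarrow> d t - c0"
      using c0 by (rule tendsto_diff)
    moreover have "d t - c0 \<noteq> 0" using t by auto
    ultimately have "\<forall>\<^sub>F n in sequentially. d (round_up \<tau> (?L n) t) - (c \<circ> r) n \<noteq> 0"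
      by (rule tendsto_imp_eventually_ne)
    then show "(\<lambda>n. ?g n (round_up \<tau> (?L n) t)) \<longlonglongrightarrow> 0"
      by (intro tendsto_eventually) (auto elim: eventually_mono)
  qed auto
  moreover have "(\<tau> / real (?L n)) * (\<Sum>l=1..?L n. ?g n (step_time \<tau> (?L n) l)) \<ge> \<tau> * \<eta>" for n
  proof -
    have "(\<Sum>l=1..?L n. ?g n (step_time \<tau> (?L n) l))
        = real (card {l \<in> {1..?L n}. d (step_time \<tau> (?L n) l) = c (r n)})"
      by (simp add: sum.If_cases Int_def)
    also have "\<dots> \<ge> \<eta> * real (?L n)" using big[of "r n"] by simp
    finally have "(\<tau> / real (?L n)) * (\<eta> * real (?L n))
        \<le> (\<tau> / real (?L n)) * (\<Sum>l=1..?L n. ?g n (step_time \<tau> (?L n) l))"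
      using \<tau> by (intro mult_left_mono) auto
    then show ?thesis using Lpos[of n] by simp
  qed
  ultimately have "\<tau> * \<eta> \<le> integral {0..\<tau>} (\<lambda>_. 0)"
    by (intro LIMSEQ_le_const) auto
  then show False using \<tau> \<eta> by (simp add: mult_le_0_iff)
qed

text \<open>Each factor satisfies \<open>0 \<le> exp (- x) - (1 - x) \<le> x\<^sup>2\<close>, and
  for factors of modulus at most \<open>1\<close> the difference of two products is at most the sum
  of the differences of the factors.\<close>

lemma prod_one_minus_diff_exp:
  fixes x :: "nat \<Rightarrow> real"
  assumes "finite A" and x: "\<And>i. i \<in> A \<Longrightarrow> 0 \<le> x i \<and> x i \<le> h" and "h \<le> 1"
  shows "\<bar>(\<Prod>i\<in>A. 1 - x i) - exp (- (\<Sum>i\<in>A. x i))\<bar> \<le> real (card A) * h\<^sup>2"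
proof -
  have "\<bar>(1 - x i) - exp (- x i)\<bar> \<le> h\<^sup>2" if "i \<in> A" for i
  proof -
    have x0: "0 \<le> x i" "x i \<le> h" using x that by auto
    have "exp (- x i) \<le> 1 / (1 + x i)"
      using x0 exp_ge_add_one_self[of "x i"] by (simp add: exp_minus field_simps)
    also have "\<dots> \<le> 1 - x i + (x i)\<^sup>2"
    proof -
      \<comment> \<open>The sum-of-cubes factorization shows that this product is at least
        \<open>1\<close>.\<close>
      have "(1 - x i + (x i)\<^sup>2) * (1 + x i) = 1 + x i ^ 3"
        by (simp add: algebra_simps power2_eq_square power3_eq_cube)
      then show ?thesis using x0 by (simp add: divide_le_eq)
    qed
    finally have "exp (- x i) \<le> 1 - x i + (x i)\<^sup>2" .
    moreover have "1 - x i \<le> exp (- x i)" using exp_ge_add_one_self[of "- x i"] by simp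
    moreover have "(x i)\<^sup>2 \<le> h\<^sup>2" using x0 by (intro power_mono) auto
    ultimately show ?thesis by linarith
  qed
  then have "(\<Sum>i\<in>A. norm ((1 - x i) - exp (- x i))) \<le> real (card A) * h\<^sup>2"
    by (intro sum_bounded_above) simp
  moreover have "norm ((\<Prod>i\<in>A. 1 - x i) - (\<Prod>i\<in>A. exp (- x i))) \<le> (\<Sum>i\<in>A. norm ((1 - x i) - exp (- x i)))"
    by (rule norm_prod_diff) (use x \<open>h \<le> 1\<close> in force)+
  ultimately show ?thesis by (simp add: exp_sum[OF \<open>finite A\<close>, symmetric] sum_negf)
qed

subsection \<open>Work along a path\<close>

definition work_plus_energy :: "(nat \<Rightarrow> real) \<Rightarrow> (nat \<Rightarrow> nat) \<Rightarrow> nat \<Rightarrow> real" where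
  "work_plus_energy d x l = (\<Sum>i=1..l. real (x (i - 1)) * (d (i - 1) - d i)) + real (x l) * d l"

text \<open>
  If the state \<open>x l\<close> flips in step \<open>l + 1\<close> and never again up to step \<open>L\<close>, then the total work
  is \<open>w\<close> exactly when \<open>d (l + 1)\<close> equals this value.
\<close>

definition critical_gap :: "(nat \<Rightarrow> real) \<Rightarrow> nat \<Rightarrow> real \<Rightarrow> (nat \<Rightarrow> nat) \<Rightarrow> nat \<Rightarrow> real" where
  "critical_gap d L w x l =
    (if x l = 0 then w - work_plus_energy d x l + d L else work_plus_energy d x l - w)"

text \<open>The level transformation trades energy for work at a constant sum; only the heat
  exchanged in a flip, which happens at the new gap \<open>d (Suc l)\<close>, changes it.\<close>

lemma work_plus_energy_Suc:
  "work_plus_energy d x (Suc l) = work_plus_energy d x l + (real (x (Suc l)) - real (x l)) * d (Suc l)"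
  by (simp add: work_plus_energy_def algebra_simps)

text \<open>The critical gap for a flip in step \<open>l + 1\<close> is fixed by the states up to
  \<open>l\<close>, which lets the Markov property bound the probability of that flip.\<close>

lemma critical_gap_cong:
  "(\<And>i. i \<le> l \<Longrightarrow> x i = y i) \<Longrightarrow> critical_gap d L w x l = critical_gap d L w y l"
  by (auto simp: critical_gap_def work_plus_energy_def intro!: sum.cong)

text \<open>After the last flip \<open>l\<close> the work plus energy stays frozen up to step
  \<open>L\<close>, where it equals \<open>w + real (x L) * d L\<close>. Solving this equation for
  \<open>d l\<close> gives the critical gap, with one formula for each direction of the
  flip.\<close>

lemma last_flip_at_critical_gap:
  assumes bin: "\<And>i. i \<le> L \<Longrightarrow> x i \<in> {0, 1}"
    and work: "(\<Sum>l=1..L. real (x (l - 1)) * (d (l - 1) - d l)) = w"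
    and flip: "\<exists>l\<in>{1..L}. x l \<noteq> x (l - 1)"
  shows "\<exists>l\<in>{1..L}. x l \<noteq> x (l - 1) \<and> d l = critical_gap d L w x (l - 1)"
proof -
  let ?J = "{l \<in> {1..L}. x l \<noteq> x (l - 1)}"
  define l where "l = Max ?J"
  have fin: "finite ?J" by simp
  have "l \<in> ?J" unfolding l_def using flip by (intro Max_in[OF fin]) auto
  then obtain k where k: "l = Suc k" "Suc k \<le> L" "x (Suc k) \<noteq> x k" by (cases l) auto
  have no_flip: "x j = x (j - 1)" if "l < j" "j \<le> L" for j
    using Max_ge[OF fin, of j] that unfolding l_def[symmetric] by fastforce
  have "x j = x l \<and> work_plus_energy d x j = work_plus_energy d x l" if "l \<le> j" "j \<le> L" for j
    using that
  proof (induction j rule: dec_induct)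
    case (step j)
    then show ?case using no_flip[of "Suc j"] by (auto simp: work_plus_energy_Suc)
  qed simp
  from this[of L] have "x L = x (Suc k)" "work_plus_energy d x L = work_plus_energy d x (Suc k)"
    using k by auto
  moreover have "work_plus_energy d x L = w + real (x L) * d L"
    using work by (simp add: work_plus_energy_def)
  moreover have "x k \<in> {0, 1}" "x (Suc k) \<in> {0, 1}" using bin k by auto
  ultimately have "d (Suc k) = critical_gap d L w x k"
    using k(3) by (auto simp: critical_gap_def work_plus_energy_Suc)
  then show ?thesis using k by (intro bexI[of _ "Suc k"]) auto
qed

text \<open>A step without a flip keeps both the state and the work plus energy, hence the critical
  gap; only a flip can add a new value.\<close>

lemma card_critical_gap_le:
  "card (critical_gap d L w x ` {..k}) \<le> 1 + card {l \<in> {1..k}. x l \<noteq> x (l - 1)}"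
proof (induction k)
  case (Suc k)
  let ?c = "critical_gap d L w x" and ?J = "\<lambda>k. {l \<in> {1..k}. x l \<noteq> x (l - 1)}"
  show ?case
  proof (cases "x (Suc k) = x k")
    case True
    then have "?c (Suc k) = ?c k" by (simp add: critical_gap_def work_plus_energy_Suc)
    then have "?c ` {..Suc k} = ?c ` {..k}" by (auto simp: atMost_Suc)
    moreover have "?J (Suc k) = ?J k" using True by (auto simp: le_Suc_eq)
    ultimately show ?thesis using Suc by simp
  next
    case False
    then have "?J (Suc k) = insert (Suc k) (?J k)" by (auto simp: le_Suc_eq)
    then have "card (?J (Suc k)) = Suc (card (?J k))" by simp
    moreover have "card (?c ` {..Suc k}) \<le> Suc (card (?c ` {..k}))"
      by (simp add: atMost_Suc card_insert_le_m1 card_insert_if)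
    ultimately show ?thesis using Suc by simp
  qed
qed simp

text \<open>The steps are sorted by the value of the critical gap: there are at most one more values
  than flips, and the gap attains each of them at most \<open>m\<close> times.\<close>

lemma count_critical_le:
  assumes m: "\<And>c. card {l \<in> {1..L}. d l = c} \<le> m"
  shows "card {l \<in> {1..L}. d l = critical_gap d L w x (l - 1)}
    \<le> (1 + card {l \<in> {1..L}. x l \<noteq> x (l - 1)}) * m"
proof -
  let ?C = "critical_gap d L w x ` {..L}"
  have "{l \<in> {1..L}. d l = critical_gap d L w x (l - 1)} \<subseteq> (\<Union>c\<in>?C. {l \<in> {1..L}. d l = c})"
    by (auto intro!: bexI[of _ "_ - Suc 0"])
  then have "card {l \<in> {1..L}. d l = critical_gap d L w x (l - 1)}
      \<le> card (\<Union>c\<in>?C. {l \<in> {1..L}. d l = c})"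
    by (intro card_mono) auto
  also have "\<dots> \<le> (\<Sum>c\<in>?C. card {l \<in> {1..L}. d l = c})" by (rule card_UN_le) simp
  also have "\<dots> \<le> card ?C * m" using sum_bounded_above[of ?C _ m] m by simp
  also have "\<dots> \<le> (1 + card {l \<in> {1..L}. x l \<noteq> x (l - 1)}) * m"
    by (intro mult_right_mono card_critical_gap_le) simp
  finally show ?thesis .
qed



subsection \<open>The two-level chain\<close>

text \<open>The Gibbs weight of the state opposite to \<open>y\<close>. Treating excitation and
  relaxation alike lets one argument serve both limits.\<close>

definition flip_weight :: "real \<Rightarrow> nat \<Rightarrow> real \<Rightarrow> real" where
  "flip_weight T y d = (if y = 0 then gibbs_excited T d else 1 - gibbs_excited T d)"

lemma flip_weight_bounds: "0 \<le> flip_weight T y d" "flip_weight T y d \<le> 1"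
  by (auto simp: flip_weight_def gibbs_excited_def add_pos_pos divide_le_eq)

lemma continuous_flip_weight:
  assumes "continuous (at t within S) f"
  shows "continuous (at t within S) (\<lambda>t. flip_weight T y (f t))"
proof -
  have "1 + exp (f t / T) \<noteq> 0" using exp_gt_zero[of "f t / T"] by linarith
  then have "continuous (at t within S) (\<lambda>t. gibbs_excited T (f t))"
    using assms unfolding continuous_within gibbs_excited_def divide_inverse
    by (intro tendsto_intros) auto
  then show ?thesis by (cases "y = 0") (auto simp: flip_weight_def intro: continuous_intros)
qed

context two_level_process
begin

abbreviation gap :: "nat \<Rightarrow> real" where
  "gap l \<equiv> \<delta> (step_time \<tau> L l)"

abbreviation resample_prob :: real where
  "resample_prob \<equiv> \<kappa> * (\<tau> / real L)"

section \<open>Events and probabilities determined by finite histories\<close>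

lemma state_binary: "l \<le> L \<Longrightarrow> \<omega> \<in> space M \<Longrightarrow> X l \<omega> \<in> {0, 1}"
  using measurable_space[OF measurable, of l \<omega>] by simp

lemma events_state:
  assumes "l \<le> L"
  shows "{\<omega> \<in> space M. X l \<omega> = y} \<in> events"
proof -
  have "{\<omega> \<in> space M. X l \<omega> = y} = X l -` ({y} \<inter> {0, 1}) \<inter> space M"
    using state_binary[OF assms] by auto
  also have "\<dots> \<in> events" by (rule measurable_sets[OF measurable[OF assms]]) auto
  finally show ?thesis .
qed

lemma events_path:
  assumes "n \<le> Suc L"
  shows "{\<omega> \<in> space M. \<forall>i<n. X i \<omega> = x i} \<in> events"
proof -
  have "{\<omega> \<in> space M. \<forall>i\<in>{..<n}. X i \<omega> = x i} \<in> events"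
    using assms by (intro sets.sets_Collect_finite_All events_state) auto
  then show ?thesis by (simp only: Ball_def lessThan_iff)
qed

text \<open>Restricting a path to its first \<open>n\<close> states does not affect
  \<open>F\<close>. The restricted paths are extensional functions into \<open>{0, 1}\<close>, so
  there are only finitely many of them.\<close>

lemma history_decomposition:
  assumes n: "n \<le> Suc L" and F: "\<And>x y. (\<And>i. i < n \<Longrightarrow> x i = y i) \<Longrightarrow> F x = F y"
  shows "{\<omega> \<in> space M. F (\<lambda>i. X i \<omega>)} =
    (\<Union>x\<in>{x \<in> {..<n} \<rightarrow>\<^sub>E {0, 1}. F x}. {\<omega> \<in> space M. \<forall>i<n. X i \<omega> = x i})" (is "?A = ?B")
proof
  show "?A \<subseteq> ?B"
  proof
    fix \<omega> assume \<omega>: "\<omega> \<in> ?A"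
    let ?x = "restrict (\<lambda>i. X i \<omega>) {..<n}"
    have "?x \<in> {..<n} \<rightarrow>\<^sub>E {0, 1}"
      unfolding restrict_PiE_iff using \<omega> n by (intro ballI state_binary) auto
    moreover have "F ?x = F (\<lambda>i. X i \<omega>)" by (rule F) simp
    ultimately show "\<omega> \<in> ?B" using \<omega> by (intro UN_I[of ?x]) auto
  qed
  show "?B \<subseteq> ?A"
  proof
    fix \<omega> assume "\<omega> \<in> ?B"
    then obtain x where x: "F x" "\<omega> \<in> space M" "\<And>i. i < n \<Longrightarrow> X i \<omega> = x i" by auto
    then show "\<omega> \<in> ?A" using F[of "\<lambda>i. X i \<omega>" x] by auto
  qed
qed

lemma finite_histories: "finite {x \<in> {..<n :: nat} \<rightarrow>\<^sub>E {0, 1 :: nat}. F x}"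
  by (rule finite_subset[OF _ finite_PiE[of "{..<n}" "\<lambda>_. {0, 1}"]]) auto

lemma events_history:
  assumes n: "n \<le> Suc L" and F: "\<And>x y. (\<And>i. i < n \<Longrightarrow> x i = y i) \<Longrightarrow> F x = F y"
  shows "{\<omega> \<in> space M. F (\<lambda>i. X i \<omega>)} \<in> events"
proof -
  have "(\<Union>x\<in>{x \<in> {..<n} \<rightarrow>\<^sub>E {0, 1}. F x}. {\<omega> \<in> space M. \<forall>i<n. X i \<omega> = x i}) \<in> events"
    by (intro sets.finite_UN finite_histories events_path n)
  then show ?thesis by (simp only: history_decomposition[of n F, OF n F])
qed

text \<open>The Markov property reduces conditioning on the path to conditioning on its last state,
  where the one-step probabilities apply. These are prescribed only for events of positive
  probability; for a null path both sides vanish.\<close>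

lemma prob_flip_path:
  assumes l: "l \<in> {1..L}" and x: "x (l - 1) \<in> {0, 1}"
  shows "\<P>(\<omega> in M. X l \<omega> = 1 - x (l - 1) \<and> (\<forall>i<l. X i \<omega> = x i)) =
    resample_prob * flip_weight T (x (l - 1)) (gap l) * \<P>(\<omega> in M. \<forall>i<l. X i \<omega> = x i)"
    (is "?P = _ * ?Q")
proof (cases "?Q > 0")
  case True
  have "?Q \<le> \<P>(\<omega> in M. X (l - 1) \<omega> = x (l - 1))"
    using l by (intro finite_measure_mono events_state) auto
  then have pos: "\<P>(\<omega> in M. X (l - 1) \<omega> = x (l - 1)) > 0" using True by simp
  have "?P = \<P>(\<omega> in M. X l \<omega> = 1 - x (l - 1) \<bar> \<forall>i<l. X i \<omega> = x i) * ?Q"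
    using True by (simp add: cond_prob_def)
  also have "\<P>(\<omega> in M. X l \<omega> = 1 - x (l - 1) \<bar> \<forall>i<l. X i \<omega> = x i) =
      \<P>(\<omega> in M. X l \<omega> = 1 - x (l - 1) \<bar> X (l - 1) \<omega> = x (l - 1))"
    by (rule markov[OF l True])
  also have "\<dots> = resample_prob * flip_weight T (x (l - 1)) (gap l)"
  proof (cases "x (l - 1) = 0")
    case True
    then show ?thesis using excite[OF l] pos by (simp add: flip_weight_def)
  next
    case False
    then have "x (l - 1) = 1" using x by simp
    then show ?thesis using relax[OF l] pos by (simp add: flip_weight_def)
  qed
  finally show ?thesis .
next
  case False
  then have "?Q = 0" using measure_nonneg[of M] by (simp add: less_le)
  moreover have "?P \<le> ?Q" using l by (intro finite_measure_mono events_path) auto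
  ultimately show ?thesis using measure_nonneg[of M] by (simp add: order_antisym)
qed

text \<open>Given any history, a flip requires resampling. The bound for a single path, with the
  flip weight estimated by \<open>1\<close>, is summed over the finitely many paths that satisfy
  \<open>F\<close>.\<close>

lemma prob_flip_history_le:
  assumes h: "0 \<le> resample_prob" and l: "l \<in> {1..L}"
    and F: "\<And>x y. (\<And>i. i < l \<Longrightarrow> x i = y i) \<Longrightarrow> F x = F y"
  shows "\<P>(\<omega> in M. X l \<omega> \<noteq> X (l - 1) \<omega> \<and> F (\<lambda>i. X i \<omega>))
    \<le> resample_prob * \<P>(\<omega> in M. F (\<lambda>i. X i \<omega>))"
proof -
  let ?A = "{x \<in> {..<l} \<rightarrow>\<^sub>E {0, 1}. F x}"
  let ?H = "\<lambda>x. {\<omega> \<in> space M. \<forall>i<l. X i \<omega> = x i}"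
  let ?J = "\<lambda>x. {\<omega> \<in> space M. X l \<omega> = 1 - x (l - 1) \<and> (\<forall>i<l. X i \<omega> = x i)}"
  have lL: "l \<le> Suc L" "l - 1 < l" using l by auto
  have decomp: "{\<omega> \<in> space M. F (\<lambda>i. X i \<omega>)} = (\<Union>x\<in>?A. ?H x)"
    by (rule history_decomposition[OF lL(1) F])
  have Hev: "?H x \<in> events" for x by (rule events_path[OF lL(1)])
  have Jev: "?J x \<in> events" for x
  proof -
    have "?J x = {\<omega> \<in> space M. X l \<omega> = 1 - x (l - 1)} \<inter> ?H x" by blast
    moreover have "{\<omega> \<in> space M. X l \<omega> = 1 - x (l - 1)} \<in> events"
      using l by (intro events_state) simp
    ultimately show ?thesis by (simp only: sets.Int Hev)
  qed
  \<comment> \<open>Disjointness makes the path probabilities add up to exactly the probability of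
    \<open>F\<close>; for the flip events a union bound is enough.\<close>
  have disj: "disjoint_family_on ?H ?A"
    unfolding disjoint_family_on_def
  proof (intro ballI impI)
    fix x y assume xy: "x \<in> ?A" "y \<in> ?A" "x \<noteq> y"
    have "\<exists>i\<in>{..<l}. x i \<noteq> y i"
    proof (rule ccontr)
      assume "\<not> ?thesis"
      then have "x = y"
        using xy by (intro PiE_ext[of x "{..<l}" "\<lambda>_. {0, 1}" y]) simp_all
      then show False using xy(3) by simp
    qed
    then obtain i where i: "i < l" "x i \<noteq> y i" by auto
    show "?H x \<inter> ?H y = {}"
    proof (rule ccontr)
      assume "\<not> ?thesis"
      then obtain \<omega> where "\<forall>i<l. X i \<omega> = x i" "\<forall>i<l. X i \<omega> = y i" by auto
      then show False using i by metis
    qed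
  qed
  have sub: "{\<omega> \<in> space M. X l \<omega> \<noteq> X (l - 1) \<omega> \<and> F (\<lambda>i. X i \<omega>)} \<subseteq> (\<Union>x\<in>?A. ?J x)"
  proof
    fix \<omega> assume \<omega>: "\<omega> \<in> {\<omega> \<in> space M. X l \<omega> \<noteq> X (l - 1) \<omega> \<and> F (\<lambda>i. X i \<omega>)}"
    then have "\<omega> \<in> {\<omega> \<in> space M. F (\<lambda>i. X i \<omega>)}" by blast
    then have "\<omega> \<in> (\<Union>x\<in>?A. ?H x)" by (simp only: decomp)
    then obtain x where x: "x \<in> ?A" "\<omega> \<in> ?H x" by blast
    then have "X (l - 1) \<omega> = x (l - 1)" using lL by simp
    moreover have "X i \<omega> \<in> {0, 1}" if "i \<le> l" for i
      by (rule state_binary) (use \<omega> l that in auto)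
    from this[of l] this[of "l - 1"] have "X l \<omega> \<in> {0, 1}" "X (l - 1) \<omega> \<in> {0, 1}" by simp_all
    ultimately have "\<omega> \<in> ?J x" using x \<omega> by auto
    then show "\<omega> \<in> (\<Union>x\<in>?A. ?J x)" using x by blast
  qed
  have "prob {\<omega> \<in> space M. X l \<omega> \<noteq> X (l - 1) \<omega> \<and> F (\<lambda>i. X i \<omega>)} \<le> prob (\<Union>x\<in>?A. ?J x)"
    by (intro finite_measure_mono sub sets.finite_UN finite_histories Jev)
  also have "\<dots> \<le> (\<Sum>x\<in>?A. prob (?J x))"
    by (intro finite_measure_subadditive_finite finite_histories image_subsetI Jev)
  also have "\<dots> \<le> (\<Sum>x\<in>?A. resample_prob * prob (?H x))"
  proof (rule sum_mono)
    fix x assume "x \<in> ?A"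
    then have "x (l - 1) \<in> {0, 1}" using lL by (auto simp: PiE_iff)
    then have "prob (?J x) = resample_prob * flip_weight T (x (l - 1)) (gap l) * prob (?H x)"
      by (rule prob_flip_path[OF l])
    also have "\<dots> \<le> resample_prob * prob (?H x)"
      using h flip_weight_bounds by (intro mult_right_mono mult_left_le) auto
    finally show "prob (?J x) \<le> resample_prob * prob (?H x)" .
  qed
  also have "\<dots> = resample_prob * prob (\<Union>x\<in>?A. ?H x)"
    by (simp only: sum_distrib_left
        finite_measure_finite_Union[OF finite_histories image_subsetI[OF Hev] disj])
  finally show ?thesis by (simp only: decomp)
qed

text \<open>Staying at \<open>y\<close> for one more step is staying so far minus flipping now, so
  each step contributes one factor. The \<open>n\<close> steps involve \<open>Suc n\<close>
  states.\<close>

lemma prob_constant_path: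
  assumes y: "y \<in> {0, 1}" and "n \<le> L"
  shows "\<P>(\<omega> in M. \<forall>i<Suc n. X i \<omega> = y) =
    (if y = 0 then 1 - p0 else p0) * (\<Prod>l=1..n. 1 - resample_prob * flip_weight T y (gap l))"
  using \<open>n \<le> L\<close>
proof (induction n)
  case 0
  have "\<P>(\<omega> in M. X 0 \<omega> = 0) = 1 - \<P>(\<omega> in M. X 0 \<omega> = 1)"
  proof -
    have "{\<omega> \<in> space M. X 0 \<omega> = 0} = space M - {\<omega> \<in> space M. X 0 \<omega> = 1}"
      using state_binary[of 0] by auto
    then show ?thesis using prob_compl[OF events_state[of 0 1]] by simp
  qed
  then show ?case using y initial by auto
next
  case (Suc n)
  let ?H = "{\<omega> \<in> space M. \<forall>i<Suc n. X i \<omega> = y}"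
  let ?J = "{\<omega> \<in> space M. X (Suc n) \<omega> = 1 - y \<and> (\<forall>i<Suc n. X i \<omega> = y)}"
  have eq: "{\<omega> \<in> space M. \<forall>i<Suc (Suc n). X i \<omega> = y} = ?H - ?J"
  proof (intro set_eqI iffI)
    fix \<omega> assume "\<omega> \<in> ?H - ?J"
    then have "\<omega> \<in> space M" "\<And>i. i < Suc n \<Longrightarrow> X i \<omega> = y" "X (Suc n) \<omega> \<noteq> 1 - y" by auto
    moreover from this(1,3) have "X (Suc n) \<omega> = y"
      using state_binary[OF Suc.prems, of \<omega>] y by auto
    ultimately show "\<omega> \<in> {\<omega> \<in> space M. \<forall>i<Suc (Suc n). X i \<omega> = y}"
      by (simp add: less_Suc_eq)
  qed (use y in force)
  have H: "?H \<in> events"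
    by (rule events_path[where x = "\<lambda>_. y"]) (use Suc.prems in linarith)
  have J: "?J \<in> events"
  proof -
    have "?J = {\<omega> \<in> space M. X (Suc n) \<omega> = 1 - y} \<inter> ?H" by blast
    then show ?thesis by (simp only:) (rule sets.Int[OF events_state[OF Suc.prems] H])
  qed
  have "?J \<subseteq> ?H" by blast
  then have "prob {\<omega> \<in> space M. \<forall>i<Suc (Suc n). X i \<omega> = y} = prob ?H - prob ?J"
    unfolding eq by (rule finite_measure_Diff[OF H J])
  moreover have "prob ?J = resample_prob * flip_weight T y (gap (Suc n)) * prob ?H"
    using prob_flip_path[of "Suc n" "\<lambda>_. y"] Suc.prems y by simp
  ultimately show ?case using Suc by (simp add: algebra_simps)
qed

section \<open>Paths with a flip and a prescribed work\<close>

text \<open>Such a path flips at a step \<open>l\<close> where the gap is critical, and being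
  critical depends on the history before \<open>l\<close>. A union bound over \<open>l\<close> gives
  the factor \<open>resample_prob\<close> times the expected number of critical steps; this number
  is at most \<open>m\<close> times one plus the number of flips, whose expectation is at most
  \<open>real L * resample_prob\<close>.\<close>

lemma prob_work_with_flip_le:
  assumes h: "0 \<le> resample_prob" and m: "\<And>c. card {l \<in> {1..L}. gap l = c} \<le> m"
  shows "\<P>(\<omega> in M. total_work \<delta> \<tau> L X \<omega> = w \<and> (\<exists>l\<in>{1..L}. X l \<omega> \<noteq> X (l - 1) \<omega>))
    \<le> resample_prob * (real m * (1 + real L * resample_prob))"
proof -
  let ?x = "\<lambda>\<omega> i. X i \<omega>"
  let ?F = "\<lambda>l x. gap l = critical_gap gap L w x (l - 1)"
  let ?C = "\<lambda>l. {\<omega> \<in> space M. ?F l (?x \<omega>)}"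
  let ?J = "\<lambda>l. {\<omega> \<in> space M. X l \<omega> \<noteq> X (l - 1) \<omega>}"
  have F: "?F l x = ?F l y" if "l \<in> {1..L}" "\<And>i. i < l \<Longrightarrow> x i = y i" for l x y
  proof -
    have "critical_gap gap L w x (l - 1) = critical_gap gap L w y (l - 1)"
      by (rule critical_gap_cong) (use that in auto)
    then show ?thesis by simp
  qed
  have Cev: "?C l \<in> events" if l: "l \<in> {1..L}" for l
    using l by (intro events_history[of l "?F l"] F[OF l]) auto
  have Jev: "?J l \<in> events" if "l \<in> {1..L}" for l
    by (rule events_history[where n = "Suc l" and F = "\<lambda>x. x l \<noteq> x (l - 1)"]) (use that in auto)
  have JCev: "?J l \<inter> ?C l \<in> events" if "l \<in> {1..L}" for l
    by (rule sets.Int[OF Jev[OF that] Cev[OF that]])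
  have CJ: "{\<omega> \<in> space M. X l \<omega> \<noteq> X (l - 1) \<omega> \<and> ?F l (?x \<omega>)} = ?J l \<inter> ?C l" for l by auto
  have "\<P>(\<omega> in M. total_work \<delta> \<tau> L X \<omega> = w \<and> (\<exists>l\<in>{1..L}. X l \<omega> \<noteq> X (l - 1) \<omega>))
      \<le> prob (\<Union>l\<in>{1..L}. ?J l \<inter> ?C l)"
  proof (rule finite_measure_mono)
    show "{\<omega> \<in> space M. total_work \<delta> \<tau> L X \<omega> = w \<and> (\<exists>l\<in>{1..L}. X l \<omega> \<noteq> X (l - 1) \<omega>)}
        \<subseteq> (\<Union>l\<in>{1..L}. ?J l \<inter> ?C l)"
    proof
      fix \<omega> assume "\<omega> \<in> {\<omega> \<in> space M. total_work \<delta> \<tau> L X \<omega> = w \<and>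
        (\<exists>l\<in>{1..L}. X l \<omega> \<noteq> X (l - 1) \<omega>)}"
      then show "\<omega> \<in> (\<Union>l\<in>{1..L}. ?J l \<inter> ?C l)"
        using last_flip_at_critical_gap[of L "?x \<omega>" gap w] state_binary[of _ \<omega>]
        unfolding total_work_def by blast
    qed
    show "(\<Union>l\<in>{1..L}. ?J l \<inter> ?C l) \<in> events"
      by (rule sets.finite_UN[OF _ JCev]) simp
  qed
  also have "\<dots> \<le> (\<Sum>l=1..L. prob (?J l \<inter> ?C l))"
    by (rule finite_measure_subadditive_finite[OF _ image_subsetI[OF JCev]]) simp
  also have "\<dots> \<le> (\<Sum>l=1..L. resample_prob * prob (?C l))"
  proof (rule sum_mono)
    fix l assume l: "l \<in> {1..L}"
    show "prob (?J l \<inter> ?C l) \<le> resample_prob * prob (?C l)"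
      unfolding CJ[symmetric] by (rule prob_flip_history_le[of l "?F l", OF h l F[OF l]])
  qed
  also have "\<dots> = resample_prob * (\<Sum>l=1..L. prob (?C l))" by (simp add: sum_distrib_left)
  also have "\<dots> \<le> resample_prob * (real m * (1 + real L * resample_prob))"
  proof (rule mult_left_mono[OF _ h])
    have ind: "integrable M (indicator A :: 'a \<Rightarrow> real)" if "A \<in> events" for A
      using that by (simp add: less_top[symmetric])
    have sum_prob: "expectation (\<lambda>\<omega>. \<Sum>l=1..L. indicator (A l) \<omega>) = (\<Sum>l=1..L. prob (A l))"
      if A: "\<And>l. l \<in> {1..L} \<Longrightarrow> A l \<in> events" for A :: "nat \<Rightarrow> 'a set"
    proof -
      have "expectation (\<lambda>\<omega>. \<Sum>l=1..L. indicator (A l) \<omega>) =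
          (\<Sum>l=1..L. expectation (indicator (A l) :: 'a \<Rightarrow> real))"
        by (rule Bochner_Integration.integral_sum) (erule ind[OF A])
      also have "\<dots> = (\<Sum>l=1..L. prob (A l))"
      proof (rule sum.cong)
        fix l assume "l \<in> {1..L}"
        then have "A l \<inter> space M = A l" using A sets.sets_into_space by blast
        then show "expectation (indicator (A l)) = prob (A l)" by simp
      qed simp
      finally show ?thesis .
    qed
    have SJ: "integrable M (\<lambda>\<omega>. \<Sum>l=1..L. indicator (?J l) \<omega> :: real)"
      by (rule Bochner_Integration.integrable_sum) (erule ind[OF Jev])
    \<comment> \<open>The sum is written as an expectation so that the combinatorial count can be
      applied path by path.\<close>
    have "(\<Sum>l=1..L. prob (?C l)) = expectation (\<lambda>\<omega>. \<Sum>l=1..L. indicator (?C l) \<omega>)"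
      by (rule sum_prob[OF Cev, symmetric])
    also have "\<dots> \<le> expectation (\<lambda>\<omega>. real m * (1 + (\<Sum>l=1..L. indicator (?J l) \<omega>)))"
    proof (rule integral_mono)
      fix \<omega> assume \<omega>: "\<omega> \<in> space M"
      have "(\<Sum>l=1..L. indicator (?C l) \<omega>) = real (card {l \<in> {1..L}. ?F l (?x \<omega>)})"
        using \<omega> by (simp add: indicator_def sum.If_cases Int_def)
      also have "\<dots> \<le> real ((1 + card {l \<in> {1..L}. X l \<omega> \<noteq> X (l - 1) \<omega>}) * m)"
        by (intro of_nat_mono count_critical_le m)
      also have "\<dots> = real m * (1 + (\<Sum>l=1..L. indicator (?J l) \<omega>))"
        using \<omega> by (simp add: indicator_def sum.If_cases Int_def algebra_simps)
      finally show "(\<Sum>l=1..L. indicator (?C l) \<omega>) \<le> real m * (1 + (\<Sum>l=1..L. indicator (?J l) \<omega>))" .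
    next
      show "integrable M (\<lambda>\<omega>. \<Sum>l=1..L. indicator (?C l) \<omega> :: real)"
        by (rule Bochner_Integration.integrable_sum) (erule ind[OF Cev])
      show "integrable M (\<lambda>\<omega>. real m * (1 + (\<Sum>l=1..L. indicator (?J l) \<omega>)))"
        by (intro integrable_mult_right Bochner_Integration.integrable_add integrable_const SJ)
    qed
    also have "\<dots> = real m * (1 + (\<Sum>l=1..L. prob (?J l)))"
      by (simp only: integral_mult_right_zero Bochner_Integration.integral_add[OF integrable_const SJ]
          sum_prob[OF Jev]) (simp add: prob_space)
    also have "\<dots> \<le> real m * (1 + (\<Sum>l=1..L. resample_prob))"
    proof (intro mult_left_mono add_left_mono sum_mono)
      \<comment> \<open>The trivial history condition gives the unconditional bound on a
        flip.\<close>
      show "prob (?J l) \<le> resample_prob" if "l \<in> {1..L}" for l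
        using prob_flip_history_le[OF h that, of "\<lambda>_. True"] by (simp add: prob_space)
    qed simp
    finally show "(\<Sum>l=1..L. prob (?C l)) \<le> real m * (1 + real L * resample_prob)" by simp
  qed
  finally show ?thesis .
qed

lemma events_work: "{\<omega> \<in> space M. total_work \<delta> \<tau> L X \<omega> = w} \<in> events"
proof -
  have "{\<omega> \<in> space M. (\<Sum>l=1..L. real (X (l - 1) \<omega>) * (gap (l - 1) - gap l)) = w} \<in> events"
  proof (rule events_history[where n = "Suc L"
        and F = "\<lambda>x. (\<Sum>l=1..L. real (x (l - 1)) * (gap (l - 1) - gap l)) = w"])
    fix x y :: "nat \<Rightarrow> nat"
    assume "\<And>i. i < Suc L \<Longrightarrow> x i = y i"
    then have "(\<Sum>l=1..L. real (x (l - 1)) * (gap (l - 1) - gap l)) =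
        (\<Sum>l=1..L. real (y (l - 1)) * (gap (l - 1) - gap l))"
      by (intro sum.cong) auto
    then show "((\<Sum>l=1..L. real (x (l - 1)) * (gap (l - 1) - gap l)) = w) =
        ((\<Sum>l=1..L. real (y (l - 1)) * (gap (l - 1) - gap l)) = w)" by simp
  qed simp
  then show ?thesis by (simp add: total_work_def)
qed

text \<open>A path without flips yields \<open>real (X 0 \<omega>) * (gap 0 - gap L)\<close> by
  telescoping. As the end gaps differ, this is the prescribed value only if the path rests at
  \<open>y\<close>, so the two events differ exactly by the paths with a flip.\<close>

lemma prob_work_approx:
  assumes h: "0 \<le> resample_prob" and m: "\<And>c. card {l \<in> {1..L}. gap l = c} \<le> m"
    and y: "y \<in> {0, 1}" and gap: "gap 0 \<noteq> gap L"
  shows "\<bar>\<P>(\<omega> in M. total_work \<delta> \<tau> L X \<omega> = real y * (gap 0 - gap L)) -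
      \<P>(\<omega> in M. \<forall>i<Suc L. X i \<omega> = y)\<bar>
    \<le> resample_prob * (real m * (1 + real L * resample_prob))"
proof -
  let ?w = "real y * (gap 0 - gap L)"
  let ?W = "{\<omega> \<in> space M. total_work \<delta> \<tau> L X \<omega> = ?w}"
  let ?H = "{\<omega> \<in> space M. \<forall>i<Suc L. X i \<omega> = y}"
  let ?J = "{\<omega> \<in> space M. total_work \<delta> \<tau> L X \<omega> = ?w \<and> (\<exists>l\<in>{1..L}. X l \<omega> \<noteq> X (l - 1) \<omega>)}"
  have work: "total_work \<delta> \<tau> L X \<omega> = real z * (gap 0 - gap L)"
    if "\<And>i. i < Suc L \<Longrightarrow> X i \<omega> = z" for \<omega> z
  proof -
    have "total_work \<delta> \<tau> L X \<omega> = (\<Sum>l=1..L. real z * (gap (l - 1) - gap l))"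
      unfolding total_work_def using that by (intro sum.cong) auto
    also have "\<dots> = real z * (\<Sum>l=1..L. gap (l - 1) - gap l)"
      by (simp only: sum_distrib_left)
    also have "(\<Sum>l=1..n. gap (l - 1) - gap l) = gap 0 - gap n" for n
      by (induction n) simp_all
    finally show ?thesis .
  qed
  have "?W - ?H = ?J"
  proof (intro set_eqI iffI)
    fix \<omega> assume \<omega>: "\<omega> \<in> ?W - ?H"
    have "\<exists>l\<in>{1..L}. X l \<omega> \<noteq> X (l - 1) \<omega>"
    proof (rule ccontr)
      assume "\<not> ?thesis"
      then have no: "\<forall>l\<in>{1..L}. X l \<omega> = X (l - 1) \<omega>" by blast
      have const: "X i \<omega> = X 0 \<omega>" if "i < Suc L" for i
        using that
      proof (induction i)
        case (Suc i)
        then show ?case using bspec[OF no, of "Suc i"] by simp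
      qed simp
      have "total_work \<delta> \<tau> L X \<omega> = ?w" using \<omega> by blast
      then have "real (X 0 \<omega>) * (gap 0 - gap L) = ?w" using work[OF const] by simp
      then have "X 0 \<omega> = y" using gap by simp
      then have "\<forall>i<Suc L. X i \<omega> = y" using const by metis
      then show False using \<omega> by blast
    qed
    then show "\<omega> \<in> ?J" using \<omega> by blast
  next
    fix \<omega> assume "\<omega> \<in> ?J"
    then obtain l where l: "\<omega> \<in> ?W" "l \<in> {1..L}" "X l \<omega> \<noteq> X (l - 1) \<omega>" by blast
    then have "l < Suc L" "l - 1 < Suc L" by auto
    then have "\<not> (\<forall>i<Suc L. X i \<omega> = y)" using l(3) by metis
    then show "\<omega> \<in> ?W - ?H" using l by blast
  qed
  moreover have "?H \<subseteq> ?W" using work[of _ y] by auto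
  ultimately have "prob ?J = prob ?W - prob ?H"
    using finite_measure_Diff[OF events_work events_path, of "Suc L" "\<lambda>_. y" ?w] by simp
  moreover have "prob ?J \<le> resample_prob * (real m * (1 + real L * resample_prob))"
    by (rule prob_work_with_flip_le[OF h m])
  ultimately show ?thesis using measure_nonneg[of M ?J] by simp
qed

end

section \<open>The continuous time limit\<close>

text \<open>Two errors vanish: that between the product \<open>P L\<close> and the exponential of a
  Riemann sum, of order \<open>h L\<close>, and that between the work probability and the
  constant-path probability, controlled by the count of a single gap level.\<close>

lemma prob_work_tendsto:
  fixes X :: "nat \<Rightarrow> nat \<Rightarrow> 'a \<Rightarrow> nat" and M :: "nat \<Rightarrow> 'a measure"
  assumes \<kappa>: "\<kappa> \<ge> 0" and \<tau>: "\<tau> > 0"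
    and protocol: "gap_protocol \<delta>min \<delta>max \<tau> \<delta>"
    and process: "\<And>L. L > 0 \<Longrightarrow> \<kappa> * (\<tau> / real L) \<le> 1 \<Longrightarrow>
      two_level_process (M L) (X L) L p0 T \<kappa> \<tau> \<delta>"
    and y: "y \<in> {0, 1}"
  shows "(\<lambda>L. \<P>(\<omega> in M L. total_work \<delta> \<tau> L (X L) \<omega> = real y * (\<delta>max - \<delta>min)))
    \<longlonglongrightarrow> (if y = 0 then 1 - p0 else p0) *
      exp (- \<kappa> * integral {0..\<tau>} (\<lambda>t. flip_weight T y (\<delta> t)))" (is "?W \<longlonglongrightarrow> ?q * exp (- \<kappa> * ?I)")
proof -
  have ends: "\<delta> 0 = \<delta>max" "\<delta> \<tau> = \<delta>min"
    and range: "\<And>t. t \<in> {0..\<tau>} \<Longrightarrow> \<delta> t \<in> {\<delta>min..\<delta>max}"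
    and cont: "negligible {t \<in> {0..\<tau>}. \<not> continuous (at t within {0..\<tau>}) \<delta>}"
    and level: "\<And>c. negligible {t \<in> {0..\<tau>}. \<delta> t = c}"
    using protocol by (simp_all only: gap_protocol_def)
  \<comment> \<open>With equal end values the gap would be constant, and one of its level sets would
    be the whole interval.\<close>
  have gap_ne: "\<delta>max \<noteq> \<delta>min"
  proof
    assume "\<delta>max = \<delta>min"
    then have "\<delta> t = \<delta>min" if "t \<in> {0..\<tau>}" for t using range[OF that] by simp
    then have "{t \<in> {0..\<tau>}. \<delta> t = \<delta>min} = {0..\<tau>}" by blast
    then have "negligible {0..\<tau>}" using level[of \<delta>min] by simp
    then show False using \<tau> negligible_interval(1)[of 0 \<tau>] by simp
  qed
  define h where "h L = \<kappa> * (\<tau> / real L)" for L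
  define P where "P L = (\<Prod>l=1..L. 1 - h L * flip_weight T y (\<delta> (step_time \<tau> L l)))" for L
  define S where "S L = (\<tau> / real L) * (\<Sum>l=1..L. flip_weight T y (\<delta> (step_time \<tau> L l)))" for L
  have h0: "0 \<le> h L" for L using \<kappa> \<tau> by (simp add: h_def)
  have h_lim: "h \<longlonglongrightarrow> 0"
    unfolding h_def
    by (intro tendsto_mult_right_zero tendsto_divide_0[OF tendsto_const]
        filterlim_at_top_imp_at_infinity filterlim_real_sequentially)
  have "\<forall>\<^sub>F L in sequentially. h L < 1" using h_lim by (rule order_tendstoD) simp
  then have ev: "\<forall>\<^sub>F L in sequentially. L > 0 \<and> h L \<le> 1"
    using eventually_gt_at_top[of 0] by eventually_elim simp
  have Lh: "real L * h L = \<kappa> * \<tau>" if "L > 0" for L using that by (simp add: h_def)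

  \<comment> \<open>The index is shifted so that all grid sizes are positive.\<close>
  have "(\<lambda>n. S (Suc n)) \<longlonglongrightarrow> ?I"
    unfolding S_def
  proof (rule riemann_sums_tendsto[OF \<tau>, where B = 1])
    show "negligible {t \<in> {0..\<tau>}. \<not> continuous (at t within {0..\<tau>}) (\<lambda>t. flip_weight T y (\<delta> t))}"
      by (rule negligible_subset[OF cont]) (auto intro: continuous_flip_weight)
  qed (use flip_weight_bounds[of T y] in \<open>auto simp: filterlim_Suc\<close>)
  then have S_lim: "S \<longlonglongrightarrow> ?I" by (rule LIMSEQ_imp_Suc)
  have "(\<lambda>L. P L - exp (- \<kappa> * S L)) \<longlonglongrightarrow> 0"
  proof (rule Lim_null_comparison)
    show "\<forall>\<^sub>F L in sequentially. norm (P L - exp (- \<kappa> * S L)) \<le> \<kappa> * \<tau> * h L"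
      using ev
    proof eventually_elim
      case (elim L)
      have "(\<Sum>l=1..L. h L * flip_weight T y (\<delta> (step_time \<tau> L l))) = \<kappa> * S L"
        by (simp add: S_def h_def sum_distrib_left mult.assoc)
      then have "\<bar>P L - exp (- (\<kappa> * S L))\<bar> \<le> real (card {1..L}) * (h L)\<^sup>2"
        using prod_one_minus_diff_exp[of "{1..L}" "\<lambda>l. h L * flip_weight T y (\<delta> (step_time \<tau> L l))" "h L"]
          elim h0 flip_weight_bounds[of T y] by (simp add: P_def mult_left_le)
      also have "real (card {1..L}) * (h L)\<^sup>2 = \<kappa> * \<tau> * h L"
        using Lh elim by (simp add: power2_eq_square mult.assoc[symmetric])
      finally show ?case by simp
    qed
    show "(\<lambda>L. \<kappa> * \<tau> * h L) \<longlonglongrightarrow> 0" using h_lim by (rule tendsto_mult_right_zero)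
  qed
  moreover have "(\<lambda>L. exp (- \<kappa> * S L)) \<longlonglongrightarrow> exp (- \<kappa> * ?I)"
    by (intro tendsto_intros S_lim)
  ultimately have P_lim: "P \<longlonglongrightarrow> exp (- \<kappa> * ?I)"
    using tendsto_add by fastforce
  have "(\<lambda>L. ?W L - ?q * P L) \<longlonglongrightarrow> 0"
  proof (rule LIMSEQ_I)
    fix e :: real assume e: "0 < e"
    \<comment> \<open>\<open>K\<close> dominates what remains of the error once the number of steps
      cancels; the summand \<open>1\<close> keeps it positive even for \<open>\<kappa> = 0\<close>.
      The choice of \<open>\<eta>\<close> then makes the error at most \<open>e / 2\<close>.\<close>
    define K where "K = \<kappa> * \<tau> * (1 + \<kappa> * \<tau>) + 1"
    have K: "K > 0" using \<kappa> \<tau> by (simp add: K_def add_nonneg_pos)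
    define \<eta> where "\<eta> = e / (2 * K)"
    have \<eta>: "\<eta> > 0" using e K by (simp add: \<eta>_def)
    obtain N1 where N1: "\<And>L c. L \<ge> N1 \<Longrightarrow>
        real (card {l \<in> {1..L}. \<delta> (step_time \<tau> L l) = c}) \<le> \<eta> * real L"
      using level_count_small[OF \<tau> \<eta> range cont level] by blast
    obtain N2 where N2: "\<And>L. L \<ge> N2 \<Longrightarrow> L > 0 \<and> h L \<le> 1"
      using ev by (auto simp: eventually_sequentially)
    have "\<bar>?W L - ?q * P L\<bar> < e" if L: "L \<ge> max N1 N2" for L
    proof -
      have L0: "L > 0" "h L \<le> 1" using N2[of L] L by auto
      then interpret two_level_process "M L" "X L" L p0 T \<kappa> \<tau> \<delta>
        by (intro process) (auto simp: h_def)
      let ?m = "nat \<lfloor>\<eta> * real L\<rfloor>"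
      have m: "card {l \<in> {1..L}. gap l = c} \<le> ?m" for c
        using N1[of L c] L by (simp add: le_nat_floor)
      have ends': "gap 0 = \<delta>max" "gap L = \<delta>min"
        using ends L0 by (auto simp: step_time_def)
      have "\<bar>?W L - \<P>(\<omega> in M L. \<forall>i<Suc L. X L i \<omega> = y)\<bar>
          \<le> h L * (real ?m * (1 + real L * h L))"
        using prob_work_approx[OF _ m y] h0[of L] gap_ne by (simp add: ends' h_def)
      also have "\<P>(\<omega> in M L. \<forall>i<Suc L. X L i \<omega> = y) = ?q * P L"
        using prob_constant_path[OF y order_refl] by (simp add: P_def h_def)
      also have "h L * (real ?m * (1 + real L * h L)) \<le> h L * (\<eta> * real L * (1 + real L * h L))"
        using h0 \<eta> by (intro mult_left_mono mult_right_mono) (auto simp: of_nat_floor)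
      \<comment> \<open>One factor \<open>real L\<close> from the level count cancels the
        \<open>1 / L\<close> in \<open>h L\<close>.\<close>
      also have "\<dots> = \<eta> * ((real L * h L) * (1 + real L * h L))" by (simp add: algebra_simps)
      also have "\<dots> = \<eta> * (\<kappa> * \<tau> * (1 + \<kappa> * \<tau>))" using Lh L0 by simp
      also have "\<dots> \<le> \<eta> * K"
        using \<eta> by (intro mult_left_mono) (auto simp: K_def)
      also have "\<dots> < e" using e K by (simp add: \<eta>_def)
      finally show ?thesis .
    qed
    then show "\<exists>N. \<forall>L\<ge>N. norm (?W L - ?q * P L - 0) < e"
      unfolding real_norm_def diff_0_right by blast
  qed
  moreover have "(\<lambda>L. ?q * P L) \<longlonglongrightarrow> ?q * exp (- \<kappa> * ?I)"
    by (intro tendsto_mult_left P_lim)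
  ultimately show ?thesis by (rule Lim_transform[rotated])
qed

theorem theorem2:
  fixes \<kappa> \<tau> T\<^sub>h p\<^sub>0 \<delta>min \<delta>max :: real
    and \<delta> :: "real \<Rightarrow> real"
    and M :: "nat \<Rightarrow> 'a measure"
    and X :: "nat \<Rightarrow> nat \<Rightarrow> 'a \<Rightarrow> nat"
  assumes "\<kappa> \<ge> 0" and "\<tau> > 0" and "T\<^sub>h > 0" and "p\<^sub>0 \<in> {0..1}"
    and "gap_protocol \<delta>min \<delta>max \<tau> \<delta>"
    and "\<And>L. L > 0 \<Longrightarrow> \<kappa> * (\<tau> / real L) \<le> 1 \<Longrightarrow>
      two_level_process (M L) (X L) L p\<^sub>0 T\<^sub>h \<kappa> \<tau> \<delta>"
  shows "((\<lambda>L. \<P>(\<omega> in M L. total_work \<delta> \<tau> L (X L) \<omega> = 0)) \<longlonglongrightarrow>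
      (1 - p\<^sub>0) * exp (- \<kappa> * integral {0..\<tau>} (\<lambda>t. gibbs_excited T\<^sub>h (\<delta> t)))) \<and>
    ((\<lambda>L. \<P>(\<omega> in M L. total_work \<delta> \<tau> L (X L) \<omega> = \<delta>max - \<delta>min)) \<longlonglongrightarrow>
      p\<^sub>0 * exp (- \<kappa> * integral {0..\<tau>} (\<lambda>t. 1 - gibbs_excited T\<^sub>h (\<delta> t))))"
proof -
  \<comment> \<open>The ground state \<open>y = 0\<close> gives zero work, the excited state
    \<open>y = 1\<close> the full gap difference.\<close>
  have lim: "(\<lambda>L. \<P>(\<omega> in M L. total_work \<delta> \<tau> L (X L) \<omega> = real y * (\<delta>max - \<delta>min)))
      \<longlonglongrightarrow> (if y = 0 then 1 - p\<^sub>0 else p\<^sub>0) *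
        exp (- \<kappa> * integral {0..\<tau>} (\<lambda>t. flip_weight T\<^sub>h y (\<delta> t)))" if "y \<in> {0, 1}" for y
    by (rule prob_work_tendsto[where M = M and X = X]) (fact assms that)+
  have "(\<lambda>L. \<P>(\<omega> in M L. total_work \<delta> \<tau> L (X L) \<omega> = 0)) \<longlonglongrightarrow>
      (1 - p\<^sub>0) * exp (- \<kappa> * integral {0..\<tau>} (\<lambda>t. gibbs_excited T\<^sub>h (\<delta> t)))"
    using lim[of 0] by (simp only: flip_weight_def if_True of_nat_0 mult_zero_left insertI1 simp_thms)
  moreover have "(\<lambda>L. \<P>(\<omega> in M L. total_work \<delta> \<tau> L (X L) \<omega> = \<delta>max - \<delta>min)) \<longlonglongrightarrow>
      p\<^sub>0 * exp (- \<kappa> * integral {0..\<tau>} (\<lambda>t. 1 - gibbs_excited T\<^sub>h (\<delta> t)))"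
    using lim[of 1] by (simp only: flip_weight_def if_False of_nat_1 mult_1 insertI1 insertI2 simp_thms
        one_neq_zero)
  ultimately show ?thesis ..
qed

end
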